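(* A Banach space $X$ has property $(K)$ if and only if $K_{1}(X)=0$.
   Context: Banach spaces are infinite-dimensional, over the real or complex field; $B_X$ denotes the closed unit ball of $X$, and $\mathcal F_X$ the family of all weakly compact subsets of $B_X$. A sequence $(y_n)_{n=1}^\infty$ is a convex block subsequence of $(x_n)_{n=1}^\infty$ if there is a strictly increasing sequence of positive integers $(k_n)_{n=1}^\infty$ such that, with $k_0=0$, $y_n\in\operatorname{conv}\{x_i: k_{n-1}+1\leqslant i\leqslant k_n\}$ for every $n\in\mathbb N$. The collection of all convex block subsequences of $(x_n)$ is denoted $\operatorname{cbs}((x_n)_{n=1}^\infty)$. $X$ has property $(K)$ if every weak$^*$ null sequence in $X^*$ admits a convex block subsequence $(f_n)_{n=1}^\infty$ such that $\lim_{n\to\infty}\langle f_n,x_n\rangle=0$ for every weakly null sequence $(x_n)_{n=1}^\infty$ in $X$. (Equivalently, $(f_n)$ converges to $0$ in the Mackey topology $\mu(X^*,X)$, the topology of uniform convergence on weakly compact subsets of $X$.) For a bounded sequence $(f_n)_{n=1}^\infty$ in $X^*$ define $$\alpha((f_n)_{n=1}^\infty)=\sup_{K\in\mathcal F_X}\limsup_{n\to\infty}\sup_{x\in K}|\langle f_n,x\rangle|,$$ and set $$K_1(X)=\sup_{(f_n)}\ \inf_{(g_n)\in\operatorname{cbs}((f_n))}\alpha((g_n)_{n=1}^\infty),$$ where the supremum is over all weak$^*$ null sequences $(f_n)_{n=1}^\infty$ in $B_{X^*}$. *)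

theory Defs
  imports "HOL-Analysis.Analysis"
begin

(* A Banach space over the scalar field 'k (used for 'k = real and 'k = complex) is a type of
   class banach together with a scalar multiplication extending the real one. For 'k = real the
   only such multiplication is scaleR. *)
locale banach_over = vector_space smul
  for smul :: "'k::real_normed_field \<Rightarrow> 'a::banach \<Rightarrow> 'a" +
  assumes smul_of_real: "smul (of_real r) x = r *\<^sub>R x"
    and norm_smul: "norm (smul c x) = norm c * norm x"

definition infinite_dimensional :: "('k::field \<Rightarrow> 'a::ab_group_add \<Rightarrow> 'a) \<Rightarrow> bool" where
  "infinite_dimensional smul \<longleftrightarrow> \<not> (\<exists>B. finite B \<and> module.span smul B = UNIV)"

(* The type of bounded linear maps only provides real-linearity; its norm is the operator norm,
   hence the dual norm on this subset. *)
definition dual_space ::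
    "('k::real_normed_field \<Rightarrow> 'a::banach \<Rightarrow> 'a) \<Rightarrow> ('a \<Rightarrow>\<^sub>L 'k) set" where
  "dual_space smul = {f. \<forall>c x. blinfun_apply f (smul c x) = c * blinfun_apply f x}"

definition weak_topology ::
    "('k::real_normed_field \<Rightarrow> 'a::banach \<Rightarrow> 'a) \<Rightarrow> 'a topology" where
  "weak_topology smul =
     topology_generated_by {blinfun_apply f -` U | f U. f \<in> dual_space smul \<and> open U}"

(* The topology euclidean on the function type is the product topology, that is, the topology of
   pointwise convergence. *)
definition weak_star_topology ::
    "('k::real_normed_field \<Rightarrow> 'a::banach \<Rightarrow> 'a) \<Rightarrow> ('a \<Rightarrow>\<^sub>L 'k) topology" where
  "weak_star_topology smul = pullback_topology (dual_space smul) blinfun_apply euclidean"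

definition weakly_null ::
    "('k::real_normed_field \<Rightarrow> 'a::banach \<Rightarrow> 'a) \<Rightarrow> (nat \<Rightarrow> 'a) \<Rightarrow> bool" where
  "weakly_null smul x \<longleftrightarrow> limitin (weak_topology smul) x 0 sequentially"

definition weak_star_null ::
    "('k::real_normed_field \<Rightarrow> 'a::banach \<Rightarrow> 'a) \<Rightarrow> (nat \<Rightarrow> 'a \<Rightarrow>\<^sub>L 'k) \<Rightarrow> bool" where
  "weak_star_null smul f \<longleftrightarrow>
     range f \<subseteq> dual_space smul \<and> limitin (weak_star_topology smul) f 0 sequentially"

(* Sequences are indexed from 0, so x i stands for the (i+1)-st term; the block of positions
   k n + 1, ..., k (n+1) in 1-based counting becomes {k n..<k (Suc n)}. *)
definition convex_block_subseqs :: "(nat \<Rightarrow> 'v::real_vector) \<Rightarrow> (nat \<Rightarrow> 'v) set" where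
  "convex_block_subseqs x =
     {y. \<exists>k::nat \<Rightarrow> nat. k 0 = 0 \<and> strict_mono k \<and>
           (\<forall>n. y n \<in> convex hull (x ` {k n..<k (Suc n)}))}"

definition property_K :: "('k::real_normed_field \<Rightarrow> 'a::banach \<Rightarrow> 'a) \<Rightarrow> bool" where
  "property_K smul \<longleftrightarrow>
     (\<forall>f. weak_star_null smul f \<longrightarrow>
        (\<exists>g\<in>convex_block_subseqs f.
           \<forall>x. weakly_null smul x \<longrightarrow> (\<lambda>n. blinfun_apply (g n) (x n)) \<longlonglongrightarrow> 0))"

definition weakly_compact_in_ball ::
    "('k::real_normed_field \<Rightarrow> 'a::banach \<Rightarrow> 'a) \<Rightarrow> 'a set set" where
  "weakly_compact_in_ball smul = {K. K \<subseteq> cball 0 1 \<and> compactin (weak_topology smul) K}"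

(* Suprema and infima are taken in ennreal, where they always exist; the empty set is a member of
   weakly_compact_in_ball and contributes 0. *)
definition alpha ::
    "('k::real_normed_field \<Rightarrow> 'a::banach \<Rightarrow> 'a) \<Rightarrow> (nat \<Rightarrow> 'a \<Rightarrow>\<^sub>L 'k) \<Rightarrow> ennreal" where
  "alpha smul f =
     (SUP K\<in>weakly_compact_in_ball smul.
        limsup (\<lambda>n. SUP x\<in>K. ennreal (norm (blinfun_apply (f n) x))))"

definition K1 :: "('k::real_normed_field \<Rightarrow> 'a::banach \<Rightarrow> 'a) \<Rightarrow> ennreal" where
  "K1 smul =
     (SUP f\<in>{f. weak_star_null smul f \<and> (\<forall>n. norm (f n) \<le> 1)}.
        INF g\<in>convex_block_subseqs f. alpha smul g)"

end

theory Submission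
  imports Defs
begin

text \<open>If \<open>g\<close> is the convex block subsequence given by property (K) but \<open>\<alpha>(g) > 0\<close>, pick points of a
  weakly compact set on which infinitely many \<open>g\<^sub>n\<close> stay away from 0. By the Eberlein--Smulian
  theorem some subsequence of these points converges weakly; subtracting its limit and filling up
  with zeros gives a weakly null sequence contradicting the choice of \<open>g\<close>. Conversely, if
  \<open>K\<^sub>1(X) = 0\<close>, normalise a weak* null sequence into the unit ball by uniform boundedness and
  iterate: take successive convex block subsequences with \<open>\<alpha> < 1/n\<close>. A diagonal one has
  \<open>\<alpha> = 0\<close>, and a weakly null sequence is bounded, so up to scaling it forms together with 0 a
  weakly compact subset of the unit ball.\<close>

section \<open>The Hahn--Banach and uniform boundedness theorems\<close>

text \<open>Homogeneity is asked only as an inequality: scaling back by \<open>1 / r\<close>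
  reverses it for \<open>r > 0\<close>, and \<open>r = 0\<close> together with subadditivity gives
  \<open>p 0 = 0\<close>.\<close>

definition sublinear :: "('a::real_vector \<Rightarrow> real) \<Rightarrow> bool" where
  "sublinear p \<longleftrightarrow> (\<forall>x y. p (x + y) \<le> p x + p y) \<and> (\<forall>r\<ge>0. \<forall>x. p (r *\<^sub>R x) \<le> r * p x)"

text \<open>For sublinear \<open>p\<close> this is the largest sublinear functional below
  \<open>p\<close> whose value at \<open>- y\<close> is at most \<open>- p y\<close>.\<close>

definition sublinear_shift :: "('a::real_vector \<Rightarrow> real) \<Rightarrow> 'a \<Rightarrow> 'a \<Rightarrow> real" where
  "sublinear_shift p y x = (INF t\<in>{0..}. p (x + t *\<^sub>R y) - t * p y)"

lemma sublinear_add: "sublinear p \<Longrightarrow> p (x + y) \<le> p x + p y"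
  and sublinear_scale: "sublinear p \<Longrightarrow> 0 \<le> r \<Longrightarrow> p (r *\<^sub>R x) \<le> r * p x"
  by (auto simp: sublinear_def)

lemma sublinear_zero: "sublinear p \<Longrightarrow> p 0 = 0"
  using sublinear_add[of p 0 0] sublinear_scale[of p 0 0] by simp

lemma sublinear_minus: "sublinear p \<Longrightarrow> - p (- x) \<le> p x"
  using sublinear_add[of p x "- x"] sublinear_zero[of p] by simp

text \<open>The bound does not depend on \<open>t\<close>, so the infimum in
  \<open>sublinear_shift\<close> is over a set bounded below. It comes from
  \<open>t * p y = p (t *\<^sub>R y)\<close> and subadditivity.\<close>

lemma sublinear_shift_lower:
  assumes "sublinear p" "0 \<le> t"
  shows "- p (- x) \<le> p (x + t *\<^sub>R y) - t * p y"
proof -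
  have "t * p y = p (t *\<^sub>R y)"
  proof (cases "t = 0")
    case False
    then have "p ((1 / t) *\<^sub>R t *\<^sub>R y) \<le> (1 / t) * p (t *\<^sub>R y)"
      using assms by (intro sublinear_scale) auto
    then have "t * p y \<le> p (t *\<^sub>R y)"
      using assms False by (simp add: field_simps)
    then show ?thesis
      using sublinear_scale[OF assms, of y] by simp
  qed (simp add: sublinear_zero assms)
  also have "\<dots> \<le> p (x + t *\<^sub>R y) + p (- x)"
    using sublinear_add[OF assms(1), of "x + t *\<^sub>R y" "- x"] by simp
  finally show ?thesis by simp
qed

lemma sublinear_shift_le:
  assumes "sublinear p" "0 \<le> t"
  shows "sublinear_shift p y x \<le> p (x + t *\<^sub>R y) - t * p y"
  unfolding sublinear_shift_def
  using sublinear_shift_lower[OF assms(1)] assms(2)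
  by (intro cINF_lower bdd_belowI2[where m = "- p (- x)"]) auto

lemma sublinear_shift_approx:
  assumes "sublinear_shift p y x < c"
  obtains t where "0 \<le> t" "p (x + t *\<^sub>R y) - t * p y < c"
proof -
  have "c \<le> sublinear_shift p y x" if "\<forall>t\<in>{0..}. c \<le> p (x + t *\<^sub>R y) - t * p y"
    unfolding sublinear_shift_def using that by (intro cINF_greatest) auto
  then show thesis
    using assms that by (force simp: not_le)
qed

lemma sublinear_shift_sublinear:
  assumes p: "sublinear p"
  shows "sublinear (sublinear_shift p y)"
  unfolding sublinear_def
proof (intro conjI allI impI)
  fix x x'
  show "sublinear_shift p y (x + x') \<le> sublinear_shift p y x + sublinear_shift p y x'"
  proof (rule field_le_epsilon)
    fix e :: real assume "0 < e"
    then have "sublinear_shift p y x < sublinear_shift p y x + e / 2"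
      and "sublinear_shift p y x' < sublinear_shift p y x' + e / 2"
      by auto
    from this(1) obtain s where
      s: "0 \<le> s" "p (x + s *\<^sub>R y) - s * p y < sublinear_shift p y x + e / 2"
      by (rule sublinear_shift_approx)
    from \<open>sublinear_shift p y x' < _\<close> obtain t where
      t: "0 \<le> t" "p (x' + t *\<^sub>R y) - t * p y < sublinear_shift p y x' + e / 2"
      by (rule sublinear_shift_approx)
    \<comment> \<open>Parameters add: \<open>s\<close> for \<open>x\<close> and \<open>t\<close> for
      \<open>x'\<close> give the admissible parameter \<open>s + t\<close> for
      \<open>x + x'\<close>.\<close>
    have "sublinear_shift p y (x + x') \<le> p ((x + s *\<^sub>R y) + (x' + t *\<^sub>R y)) - (s + t) * p y"
      using sublinear_shift_le[OF p, of "s + t" y "x + x'"] s t by (simp add: algebra_simps)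
    also have "\<dots> \<le> p (x + s *\<^sub>R y) + p (x' + t *\<^sub>R y) - (s + t) * p y"
      using sublinear_add[OF p] by simp
    finally show "sublinear_shift p y (x + x')
        \<le> sublinear_shift p y x + sublinear_shift p y x' + e"
      using s t by (simp add: algebra_simps)
  qed
next
  fix r :: real and x assume r: "0 \<le> r"
  show "sublinear_shift p y (r *\<^sub>R x) \<le> r * sublinear_shift p y x"
  proof (rule field_le_epsilon)
    fix e :: real assume e: "0 < e"
    \<comment> \<open>Dividing by \<open>r + 1\<close> rather than \<open>r\<close> also covers
      \<open>r = 0\<close>, and \<open>r * (e / (r + 1)) \<le> e\<close>.\<close>
    obtain t where t: "0 \<le> t" "p (x + t *\<^sub>R y) - t * p y < sublinear_shift p y x + e / (r + 1)"
      by (rule sublinear_shift_approx[of p y x "sublinear_shift p y x + e / (r + 1)"])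
        (use e r in auto)
    have "sublinear_shift p y (r *\<^sub>R x) \<le> p (r *\<^sub>R (x + t *\<^sub>R y)) - (r * t) * p y"
      using sublinear_shift_le[OF p, of "r * t" y "r *\<^sub>R x"] r t by (simp add: algebra_simps)
    also have "\<dots> \<le> r * (p (x + t *\<^sub>R y) - t * p y)"
      using sublinear_scale[OF p r, of "x + t *\<^sub>R y"] by (simp add: algebra_simps)
    also have "\<dots> \<le> r * (sublinear_shift p y x + e / (r + 1))"
      using t r by (intro mult_left_mono) auto
    also have "\<dots> \<le> r * sublinear_shift p y x + e"
      using e r by (simp add: field_simps)
    finally show "sublinear_shift p y (r *\<^sub>R x) \<le> r * sublinear_shift p y x + e" .
  qed
qed

text \<open>A minimal sublinear functional equals all its shifts, which makes it odd and hence linear.\<close>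
lemma sublinear_linear_minorant:
  fixes p :: "'a::real_vector \<Rightarrow> real"
  assumes p: "sublinear p"
  shows "\<exists>f. linear f \<and> (\<forall>x. f x \<le> p x)"
proof -
  define A where "A = {q. sublinear q \<and> (\<forall>x. q x \<le> p x)}"
  \<comment> \<open>The order is reversed: larger in the sense of \<open>P\<close> means pointwise
    smaller, so Zorn's lemma yields a minimal functional and chains are bounded by infima.\<close>
  define P where "P = (\<lambda>a b::'a \<Rightarrow> real. \<forall>x. b x \<le> a x)"
  have "\<exists>m\<in>A. \<forall>a\<in>A. P m a \<longrightarrow> a = m"
  proof (rule predicate_Zorn)
    show "partial_order_on A (relation_of P A)"
      by (intro partial_order_on_relation_ofI)
        (auto simp: P_def fun_eq_iff intro: order_trans order_antisym)
  next
    fix C assume C: "C \<in> Chains (relation_of P A)"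
    then have CA: "C \<subseteq> A"
      by (auto simp: Chains_def relation_of_def)
    have comparable: "P a b \<or> P b a" if "a \<in> C" "b \<in> C" for a b
      using C that by (auto simp: Chains_def relation_of_def)
    show "\<exists>u\<in>A. \<forall>a\<in>C. P a u"
    proof (cases "C = {}")
      case True
      then show ?thesis
        using p by (auto simp: A_def)
    next
      case False
      define u where "u = (\<lambda>x. INF q\<in>C. q x)"
      have low: "- p (- x) \<le> q x" if "q \<in> C" for q x
      proof -
        have "sublinear q" "q (- x) \<le> p (- x)"
          using that CA by (auto simp: A_def)
        then show ?thesis
          using sublinear_minus[of q x] by simp
      qed
      have u_le: "u x \<le> q x" if "q \<in> C" for q x
        unfolding u_def using low that by (intro cINF_lower bdd_belowI2[where m = "- p (- x)"]) auto
      have u_ge: "c \<le> u x" if "\<And>q. q \<in> C \<Longrightarrow> c \<le> q x" for c x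
        unfolding u_def using False that by (intro cINF_greatest) auto
      have "sublinear u"
        unfolding sublinear_def
      proof (intro conjI allI impI)
        fix x y
        \<comment> \<open>The infima at \<open>x\<close> and \<open>y\<close> may be approached by
          different members of the chain; comparability supplies one member \<open>c\<close> that is
          below \<open>a\<close> at \<open>x\<close> and below \<open>b\<close> at
          \<open>y\<close>.\<close>
        have "u (x + y) - a x \<le> b y" if ab: "a \<in> C" "b \<in> C" for a b
        proof -
          obtain c where c: "c \<in> C" "c x \<le> a x" "c y \<le> b y"
            using comparable[OF ab] ab by (auto simp: P_def)
          then have "sublinear c"
            using CA by (auto simp: A_def)
          then show ?thesis
            using c u_le[OF c(1), of "x + y"] sublinear_add[of c x y] by simp
        qed
        then have "u (x + y) - a x \<le> u y" if "a \<in> C" for a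
          using that by (intro u_ge)
        then have "u (x + y) - u y \<le> u x"
          by (intro u_ge) (simp add: algebra_simps)
        then show "u (x + y) \<le> u x + u y"
          by simp
      next
        fix r :: real and x assume r: "0 \<le> r"
        have le: "u (r *\<^sub>R x) \<le> r * q x" if "q \<in> C" for q
          using u_le[OF that, of "r *\<^sub>R x"] sublinear_scale[of q r x] r that CA
          by (force simp: A_def)
        show "u (r *\<^sub>R x) \<le> r * u x"
        proof (cases "r = 0")
          case True
          then show ?thesis
            using le False by auto
        next
          case nz: False
          then have "u (r *\<^sub>R x) / r \<le> u x"
            using le r by (intro u_ge) (simp add: field_simps)
          then show ?thesis
            using nz r by (simp add: field_simps)
        qed
      qed
      moreover have "u x \<le> p x" for x
      proof -
        obtain q where "q \<in> C" "q x \<le> p x"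
          using False CA by (auto simp: A_def)
        then show ?thesis
          using u_le[of q x] by simp
      qed
      ultimately show ?thesis
        using u_le by (auto simp: A_def P_def)
    qed
  qed
  then obtain m where "m \<in> A" and le_eq: "\<And>a. a \<in> A \<Longrightarrow> P m a \<Longrightarrow> a = m"
    by blast
  then have m: "sublinear m" "\<And>x. m x \<le> p x"
    by (auto simp: A_def)
  have minimal: "a = m" if "sublinear a" "\<And>x. a x \<le> m x" for a
    using that m(2) by (intro le_eq) (auto simp: A_def P_def intro: order_trans)
  \<comment> \<open>\<open>t = 0\<close> places each shift below \<open>m\<close>, so minimality
    makes them equal; \<open>t = 1\<close> at \<open>- y\<close> then gives
    \<open>m (- y) \<le> m 0 - m y\<close>.\<close>
  have neg: "m (- y) = - m y" for y
  proof -
    have "sublinear_shift m y x \<le> m x" for x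
      using sublinear_shift_le[OF m(1), of 0 y x] by simp
    then have "sublinear_shift m y = m"
      by (intro minimal sublinear_shift_sublinear m)
    then have "m (- y) \<le> - m y"
      using sublinear_shift_le[OF m(1), of 1 y "- y"] sublinear_zero[OF m(1)] by simp
    then show ?thesis
      using sublinear_minus[OF m(1), of y] by simp
  qed
  have add: "m (x + y) = m x + m y" for x y
    using sublinear_add[OF m(1), of x y] sublinear_add[OF m(1), of "- x" "- y"]
      neg[of x] neg[of y] neg[of "x + y"] by simp
  have pos: "m (r *\<^sub>R x) = r * m x" if "0 \<le> r" for r x
    using sublinear_scale[OF m(1) that, of x] sublinear_scale[OF m(1) that, of "- x"]
      neg[of x] neg[of "r *\<^sub>R x"] by simp
  have "m (r *\<^sub>R x) = r * m x" for r x
    using pos[of r x] pos[of "- r" x] neg[of "r *\<^sub>R x"] by (cases "0 \<le> r") auto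
  then have "linear m"
    using add by (intro linearI) auto
  then show ?thesis
    using m by blast
qed

section \<open>Hahn-Banach for the distance to a subspace\<close>

lemma infdist_subspace_sublinear:
  fixes S :: "'a::real_normed_vector set"
  assumes S: "subspace S"
  shows "sublinear (\<lambda>x. infdist x S)"
proof -
  have ne: "S \<noteq> {}"
    using subspace_0[OF S] by auto
  have approx: "\<exists>s\<in>S. norm (x - s) < infdist x S + e" if "0 < e" for x e
  proof (rule ccontr)
    assume "\<not> ?thesis"
    then have "infdist x S + e \<le> infdist x S"
      unfolding infdist_notempty[OF ne] dist_norm
      by (intro cINF_greatest[OF ne]) (auto simp: not_less)
    then show False
      using that by simp
  qed
  have le: "infdist x S \<le> norm (x - s)" if "s \<in> S" for x s
    using infdist_le[OF that, of x] by (simp add: dist_norm)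
  show ?thesis
    unfolding sublinear_def
  proof (intro conjI allI impI; rule field_le_epsilon)
    fix x y :: 'a and e :: real assume "0 < e"
    then obtain s t where st: "s \<in> S" "norm (x - s) < infdist x S + e / 2"
      "t \<in> S" "norm (y - t) < infdist y S + e / 2"
      using approx[of "e / 2"] by (meson half_gt_zero)
    have "infdist (x + y) S \<le> norm ((x - s) + (y - t))"
      using le[OF subspace_add[OF S st(1) st(3)], of "x + y"] by (simp add: algebra_simps)
    then show "infdist (x + y) S \<le> infdist x S + infdist y S + e"
      using norm_triangle_ineq[of "x - s" "y - t"] st by simp
  next
    fix r e :: real and x :: 'a assume r: "0 \<le> r" and e: "0 < e"
    then obtain s where s: "s \<in> S" "norm (x - s) < infdist x S + e / (r + 1)"
      using approx[of "e / (r + 1)" x] by auto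
    have "infdist (r *\<^sub>R x) S \<le> norm (r *\<^sub>R (x - s))"
      using le[OF subspace_scale[OF S s(1)], of "r *\<^sub>R x" r] by (simp add: algebra_simps)
    also have "\<dots> \<le> r * (infdist x S + e / (r + 1))"
      using r s by (simp add: mult_left_mono)
    also have "\<dots> \<le> r * infdist x S + e"
      using e r by (simp add: field_simps)
    finally show "infdist (r *\<^sub>R x) S \<le> r * infdist x S + e" .
  qed
qed

text \<open>Take a linear minorant \<open>f\<close> of the shift of the distance functional in
  direction \<open>x\<close>. Lying below the distance, \<open>f\<close> vanishes on
  \<open>S\<close> and has norm at most 1; the shift forces \<open>f (- x)\<close> to be at most
  \<open>- infdist x S\<close>.\<close>

theorem hahn_banach_subspace:
  fixes S :: "'a::real_normed_vector set"
  assumes S: "subspace S"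
  shows "\<exists>u::'a \<Rightarrow>\<^sub>L real. norm u \<le> 1 \<and> (\<forall>s\<in>S. blinfun_apply u s = 0) \<and>
    infdist x S \<le> blinfun_apply u x"
proof -
  let ?p = "\<lambda>x. infdist x S"
  have p: "sublinear ?p"
    by (rule infdist_subspace_sublinear[OF S])
  obtain f where f: "linear f" "\<And>z. f z \<le> sublinear_shift ?p x z"
    using sublinear_linear_minorant[OF sublinear_shift_sublinear[OF p, of x]] by blast
  have le: "f z \<le> infdist z S" for z
    using f(2)[of z] sublinear_shift_le[OF p, of 0 x z] by simp
  have "infdist z S \<le> norm z" for z
    using infdist_le[OF subspace_0[OF S], of z] by simp
  then have bound: "norm (f z) \<le> norm z * 1" for z
    using le[of z] le[of "- z"] linear_neg[OF f(1), of z] by (smt (verit) norm_minus_cancel real_norm_def)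
  then have bl: "bounded_linear f"
    using f(1) by (intro bounded_linear_intro[where K = 1]) (auto simp: linear_add linear_scale)
  have "f (- x) \<le> sublinear_shift ?p x (- x)"
    by (rule f)
  also have "\<dots> \<le> - infdist x S"
    using sublinear_shift_le[OF p, of 1 x "- x"] sublinear_zero[OF p] by simp
  finally have "infdist x S \<le> f x"
    using linear_neg[OF f(1), of x] by simp
  moreover have "f s = 0" if "s \<in> S" for s
    using le[of s] le[of "- s"] that subspace_neg[OF S that] linear_neg[OF f(1), of s]
    by simp
  moreover have "norm (Blinfun f) \<le> 1"
    using bound by (intro norm_blinfun_bound) (auto simp: bounded_linear_Blinfun_apply[OF bl])
  ultimately show ?thesis
    by (intro exI[of _ "Blinfun f"]) (simp add: bounded_linear_Blinfun_apply[OF bl])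
qed

text \<open>By Baire, one of the closed sets \<open>A k\<close> on which all operators are bounded
  by \<open>k\<close> contains a ball. Differences of points of that ball fill a neighbourhood of 0,
  and one point being the centre already suffices for the bound.\<close>

theorem uniform_boundedness:
  fixes T :: "'i \<Rightarrow> 'a::banach \<Rightarrow>\<^sub>L 'b::real_normed_vector"
  assumes "\<And>x. bounded (range (\<lambda>i. T i x))"
  shows "bounded (range T)"
proof -
  define A where "A k = {x. \<forall>i. norm (T i x) \<le> real k}" for k
  have closed: "closed (A k)" for k
    unfolding A_def by (intro closed_Collect_all closed_Collect_le continuous_intros)
  have "\<exists>k. interior (A k) \<noteq> {}"
  proof (rule ccontr)
    assume "\<not> ?thesis"
    then have "Met_TC.mtopology interior_of \<Union>(range A) = {}"
      using closed by (intro Met_TC.metric_Baire_category_alt) (auto simp: complete_UNIV)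
    moreover have "x \<in> \<Union>(range A)" for x
    proof -
      obtain b where "\<And>i. norm (T i x) \<le> b"
        using assms[of x] by (auto simp: bounded_iff)
      then show ?thesis
        using real_arch_simple[of b] by (auto simp: A_def intro: order_trans)
    qed
    then have "\<Union>(range A) = UNIV"
      by blast
    ultimately show False
      by simp
  qed
  then obtain k x e where e: "0 < e" "cball x e \<subseteq> A k"
    by (metis all_not_in_conv mem_interior_cball)
  have "norm (T i) \<le> 2 * real k / e" for i
  proof (rule norm_blinfun_bound)
    fix y
    show "norm (T i y) \<le> 2 * real k / e * norm y"
    proof (cases "y = 0")
      \<comment> \<open>\<open>z\<close> has norm \<open>e\<close>, so that \<open>x + z\<close>
        stays in the closed ball; undoing the scaling produces the constant
        \<open>2 * real k / e\<close>.\<close>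
      case False
      define z where "z = (e / norm y) *\<^sub>R y"
      have "x \<in> cball x e" "x + z \<in> cball x e"
        using e False by (auto simp: z_def dist_norm)
      then have "norm (T i x) \<le> k" "norm (T i (x + z)) \<le> k"
        using e(2) unfolding A_def by blast+
      moreover have "T i z = T i (x + z) - T i x"
        by (simp add: blinfun.add_right)
      ultimately have "norm (T i z) \<le> 2 * k"
        using norm_triangle_ineq4[of "T i (x + z)" "T i x"] by simp
      then show ?thesis
        using e False by (simp add: z_def blinfun.scaleR_right field_simps)
    qed simp
  qed (use e in auto)
  then show ?thesis
    by (auto simp: bounded_iff)
qed

section \<open>Convex blocks and weak topologies\<close>

text \<open>Unlike being a convex block subsequence, this relation is transitive by a hull argument
  and ignores finitely many terms, as the diagonal argument requires.\<close>
definition eventually_in_tail_hulls :: "(nat \<Rightarrow> 'v::real_vector) \<Rightarrow> (nat \<Rightarrow> 'v) \<Rightarrow> bool" where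
  "eventually_in_tail_hulls v u \<longleftrightarrow> (\<forall>N. \<forall>\<^sub>F i in sequentially. v i \<in> convex hull (u ` {N..}))"

lemma eventually_in_tail_hulls_refl: "eventually_in_tail_hulls u u"
  unfolding eventually_in_tail_hulls_def
proof
  fix N
  show "\<forall>\<^sub>F i in sequentially. u i \<in> convex hull (u ` {N..})"
    using eventually_ge_at_top[of N] by eventually_elim (simp add: hull_inc)
qed

text \<open>The transport principle: a convex set containing a tail of \<open>u\<close> contains its
  hull, hence all but finitely many \<open>v i\<close>. Transitivity, monotonicity of
  \<open>alpha\<close> and weak* limits are instances for suitable \<open>C\<close>.\<close>

lemma eventually_in_tail_hulls_convex:
  assumes "eventually_in_tail_hulls v u" "convex C" "\<forall>\<^sub>F i in sequentially. u i \<in> C"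
  shows "\<forall>\<^sub>F i in sequentially. v i \<in> C"
proof -
  obtain N where "u ` {N..} \<subseteq> C"
    using assms(3) by (auto simp: eventually_sequentially)
  then have "convex hull (u ` {N..}) \<subseteq> C"
    using assms(2) by (rule hull_minimal)
  moreover have "\<forall>\<^sub>F i in sequentially. v i \<in> convex hull (u ` {N..})"
    using assms(1) by (simp add: eventually_in_tail_hulls_def)
  ultimately show ?thesis
    by (auto elim: eventually_mono)
qed

lemma eventually_in_tail_hulls_trans:
  assumes "eventually_in_tail_hulls w v" "eventually_in_tail_hulls v u"
  shows "eventually_in_tail_hulls w u"
  using eventually_in_tail_hulls_convex[OF assms(1) convex_convex_hull] assms(2)
  by (simp add: eventually_in_tail_hulls_def)

lemma convex_block_subseqs_tail_hulls:
  assumes "v \<in> convex_block_subseqs u"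
  shows "eventually_in_tail_hulls v u"
proof -
  obtain k where k: "strict_mono k" "\<And>n. v n \<in> convex hull (u ` {k n..<k (Suc n)})"
    using assms by (auto simp: convex_block_subseqs_def)
  have "v i \<in> convex hull (u ` {N..})" if "N \<le> i" for N i
  proof -
    have "{k i..<k (Suc i)} \<subseteq> {N..}"
      using strict_mono_imp_increasing[OF k(1), of i] that by auto
    then show ?thesis
      using k(2)[of i] hull_mono[OF image_mono, of "{k i..<k (Suc i)}" "{N..}" convex u] by blast
  qed
  then show ?thesis
    by (auto simp: eventually_in_tail_hulls_def eventually_sequentially)
qed

lemma convex_block_subseqs_subset:
  assumes "v \<in> convex_block_subseqs u" "convex C" "range u \<subseteq> C"
  shows "range v \<subseteq> C"
proof -
  obtain k :: "nat \<Rightarrow> nat" where k: "\<And>n. v n \<in> convex hull (u ` {k n..<k (Suc n)})"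
    using assms(1) by (auto simp: convex_block_subseqs_def)
  have "convex hull (u ` {k n..<k (Suc n)}) \<subseteq> C" for n
    using assms(2,3) by (intro hull_minimal) auto
  then show ?thesis
    using k by blast
qed

lemma convex_block_subseqs_scaleR:
  assumes "v \<in> convex_block_subseqs u"
  shows "(\<lambda>n. c *\<^sub>R v n) \<in> convex_block_subseqs (\<lambda>n. c *\<^sub>R u n)"
proof -
  have "c *\<^sub>R y \<in> convex hull ((\<lambda>n. c *\<^sub>R u n) ` I)" if "y \<in> convex hull (u ` I)" for y I
    using that convex_hull_scaling[of c "u ` I"] by (auto simp: image_image)
  then show ?thesis
    using assms by (auto simp: convex_block_subseqs_def)
qed

section \<open>Diagonal convex block subsequences\<close>

lemma convex_hull_tail_finite:
  fixes u :: "nat \<Rightarrow> 'v::real_vector"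
  assumes "y \<in> convex hull (u ` {k..})"
  obtains k' where "k < k'" "y \<in> convex hull (u ` {k..<k'})"
proof -
  obtain S where S: "finite S" "S \<subseteq> u ` {k..}" "y \<in> convex hull S"
    using assms unfolding convex_hull_explicit[of "u ` {k..}"] convex_hull_explicit by blast
  obtain I where I: "finite I" "I \<subseteq> {k..}" "S = u ` I"
    using finite_subset_image[OF S(1,2)] by blast
  \<comment> \<open>Inserting \<open>k\<close> makes the maximum defined and at least
    \<open>k\<close>, so \<open>k < k'\<close> needs no information about \<open>I\<close>.\<close>
  define k' where "k' = Suc (Max (insert k I))"
  have "I \<subseteq> {k..<k'}"
    using I by (auto simp: k'_def less_Suc_eq_le)
  moreover have "k < k'"
    using I by (simp add: k'_def less_Suc_eq_le)
  ultimately show thesis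
    using that[of k'] S(3) I(3) hull_mono[OF image_mono, of I "{k..<k'}" convex u] by blast
qed

text \<open>Every late enough term of \<open>g n\<close> lies in prescribed tail hulls of all
  \<open>g m\<close> with \<open>m \<le> n\<close>. One such term is taken for each
  \<open>n\<close>, far enough out that as a combination of terms of \<open>g 0\<close> it uses only
  those past the previous block.\<close>

lemma convex_block_diagonal:
  fixes g :: "nat \<Rightarrow> nat \<Rightarrow> 'v::real_vector"
  assumes "\<And>m. g (Suc m) \<in> convex_block_subseqs (g m)"
  shows "\<exists>h\<in>convex_block_subseqs (g 0). \<forall>m. eventually_in_tail_hulls h (g m)"
proof -
  have tail: "eventually_in_tail_hulls (g n) (g m)" if "m \<le> n" for m n
    using that
    by (induction n rule: dec_induct)
      (auto intro: eventually_in_tail_hulls_refl eventually_in_tail_hulls_trans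
        convex_block_subseqs_tail_hulls assms)
  \<comment> \<open>\<open>k\<close> is where the block starts, \<open>k'\<close> its exclusive end
    and \<open>y\<close> the new term; having this for every \<open>k\<close> permits the recursion
    that fixes the block boundaries.\<close>
  have "\<forall>n k. \<exists>k' y. k < k' \<and> y \<in> convex hull (g 0 ` {k..<k'}) \<and>
      (\<forall>m\<le>n. y \<in> convex hull (g m ` {n..}))"
  proof (intro allI)
    fix n k
    have "\<forall>\<^sub>F i in sequentially. \<forall>m\<in>{..n}. g n i \<in> convex hull (g m ` {n..})"
      using tail by (intro eventually_ball_finite) (auto simp: eventually_in_tail_hulls_def)
    moreover have "\<forall>\<^sub>F i in sequentially. g n i \<in> convex hull (g 0 ` {k..})"
      using tail[of 0 n] by (auto simp: eventually_in_tail_hulls_def)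
    ultimately have "\<forall>\<^sub>F i in sequentially. g n i \<in> convex hull (g 0 ` {k..}) \<and>
        (\<forall>m\<in>{..n}. g n i \<in> convex hull (g m ` {n..}))"
      by eventually_elim auto
    then obtain i where i: "g n i \<in> convex hull (g 0 ` {k..})"
        "\<forall>m\<in>{..n}. g n i \<in> convex hull (g m ` {n..})"
      by (auto simp: eventually_sequentially)
    then show "\<exists>k' y. k < k' \<and> y \<in> convex hull (g 0 ` {k..<k'}) \<and>
        (\<forall>m\<le>n. y \<in> convex hull (g m ` {n..}))"
      using convex_hull_tail_finite[OF i(1)] by (metis atMost_iff)
  qed
  then obtain K y where Ky: "\<forall>n k. k < K n k \<and> y n k \<in> convex hull (g 0 ` {k..<K n k}) \<and>
      (\<forall>m\<le>n. y n k \<in> convex hull (g m ` {n..}))"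
    unfolding choice_iff by blast
  define k where "k = rec_nat 0 K"
  define h where "h n = y n (k n)" for n
  have k_simps: "k 0 = 0" "k (Suc n) = K n (k n)" for n
    by (simp_all add: k_def)
  have "h \<in> convex_block_subseqs (g 0)"
    unfolding convex_block_subseqs_def h_def
    using Ky by (intro CollectI exI[of _ k]) (auto simp: k_simps strict_mono_Suc_iff)
  moreover have "eventually_in_tail_hulls h (g m)" for m
    unfolding eventually_in_tail_hulls_def
  proof
    fix N
    show "\<forall>\<^sub>F i in sequentially. h i \<in> convex hull (g m ` {N..})"
      using eventually_ge_at_top[of "max m N"]
    proof eventually_elim
      fix i assume i: "max m N \<le> i"
      then have "g m ` {i..} \<subseteq> g m ` {N..}"
        by auto
      then show "h i \<in> convex hull (g m ` {N..})"
        using Ky i hull_mono[of "g m ` {i..}" "g m ` {N..}" convex]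
        unfolding h_def by auto
    qed
  qed
  ultimately show ?thesis
    by blast
qed

text \<open>Turns convergence along a subsequence into convergence of a sequence padded with zeros;
  needed because property (K) pairs \<open>g n\<close> with the vector at the same index
  \<open>n\<close>.\<close>

lemma tendsto_zero_extend:
  fixes u :: "nat \<Rightarrow> 'b::real_normed_vector"
  assumes r: "strict_mono r" and lim: "(\<lambda>k. u (r k)) \<longlonglongrightarrow> 0"
    and zero: "\<And>n. n \<notin> range r \<Longrightarrow> u n = 0"
  shows "u \<longlonglongrightarrow> 0"
proof (rule LIMSEQ_I)
  fix e :: real assume e: "0 < e"
  then obtain N where N: "\<And>k. N \<le> k \<Longrightarrow> norm (u (r k)) < e"
    using LIMSEQ_D[OF lim e] by auto
  have "norm (u n - 0) < e" if "r N \<le> n" for n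
    using N zero[of n] e that strict_mono_less_eq[OF r] by (cases "n \<in> range r") auto
  then show "\<exists>no. \<forall>n\<ge>no. norm (u n - 0) < e"
    by blast
qed

text \<open>For fixed \<open>K\<close> and \<open>s\<close>, the functionals bounded by
  \<open>s\<close> on \<open>K\<close> form a convex set. With \<open>s\<close> a tail supremum of
  \<open>u\<close> it eventually contains \<open>u\<close>, hence eventually
  \<open>v\<close>.\<close>

lemma alpha_tail_hulls:
  fixes u v :: "nat \<Rightarrow> 'a::banach \<Rightarrow>\<^sub>L 'k::real_normed_field"
  assumes "eventually_in_tail_hulls v u"
  shows "alpha smul v \<le> alpha smul u"
proof -
  have "limsup (\<lambda>n. SUP x\<in>K. ennreal (norm (blinfun_apply (v n) x)))
      \<le> limsup (\<lambda>n. SUP x\<in>K. ennreal (norm (blinfun_apply (u n) x)))" for K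
    unfolding limsup_INF_SUP[of "\<lambda>n. SUP x\<in>K. ennreal (norm (blinfun_apply (u n) x))"]
  proof (intro INF_greatest)
    fix N
    define s where "s = (SUP m\<in>{N..}. SUP x\<in>K. ennreal (norm (blinfun_apply (u m) x)))"
    define C where "C = {f :: 'a \<Rightarrow>\<^sub>L 'k. \<forall>x\<in>K. ennreal (norm (blinfun_apply f x)) \<le> s}"
    have "convex C"
    proof (rule convexI)
      fix f g and a b :: real
      assume fg: "f \<in> C" "g \<in> C" and ab: "0 \<le> a" "0 \<le> b" "a + b = 1"
      have "ennreal (norm (blinfun_apply (a *\<^sub>R f + b *\<^sub>R g) x)) \<le> s" if "x \<in> K" for x
      proof -
        let ?m = "max (norm (f x)) (norm (g x))"
        have "norm (blinfun_apply (a *\<^sub>R f + b *\<^sub>R g) x) \<le> a * norm (f x) + b * norm (g x)"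
          using ab norm_triangle_ineq[of "a *\<^sub>R f x" "b *\<^sub>R g x"]
          by (simp add: blinfun.add_left blinfun.scaleR_left)
        also have "\<dots> \<le> a * ?m + b * ?m"
          using ab by (intro add_mono mult_left_mono) auto
        also have "\<dots> = ?m"
          using ab by (simp flip: distrib_right)
        finally have "ennreal (norm (blinfun_apply (a *\<^sub>R f + b *\<^sub>R g) x)) \<le> ennreal ?m"
          by (rule ennreal_leI)
        also have "\<dots> \<le> s"
          using fg that by (auto simp: C_def max_def)
        finally show ?thesis .
      qed
      then show "a *\<^sub>R f + b *\<^sub>R g \<in> C"
        by (simp add: C_def)
    qed
    moreover have "u i \<in> C" if "N \<le> i" for i
      using that unfolding C_def s_def by (auto intro!: SUP_upper2[of i] SUP_upper)
    then have "\<forall>\<^sub>F i in sequentially. u i \<in> C"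
      by (auto simp: eventually_sequentially)
    ultimately have "\<forall>\<^sub>F i in sequentially. v i \<in> C"
      by (rule eventually_in_tail_hulls_convex[OF assms])
    then have "\<forall>\<^sub>F i in sequentially. (SUP x\<in>K. ennreal (norm (blinfun_apply (v i) x))) \<le> s"
      by eventually_elim (auto simp: C_def intro: SUP_least)
    then show "limsup (\<lambda>n. SUP x\<in>K. ennreal (norm (blinfun_apply (v n) x)))
        \<le> (SUP m\<in>{N..}. SUP x\<in>K. ennreal (norm (blinfun_apply (u m) x)))"
      unfolding s_def by (rule Limsup_bounded)
  qed
  then show ?thesis
    unfolding alpha_def by (intro SUP_mono) blast
qed

section \<open>Weak and weak* convergence tested pointwise\<close>

lemma weak_star_null_iff:
  "weak_star_null smul f \<longleftrightarrow> range f \<subseteq> dual_space smul \<and> (\<forall>x. (\<lambda>n. blinfun_apply (f n) x) \<longlonglongrightarrow> 0)"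
proof (cases "range f \<subseteq> dual_space smul")
  case True
  have zero: "0 \<in> dual_space smul"
    by (simp add: dual_space_def)
  \<comment> \<open>Open sets of the pullback are traces of preimages of product-open sets, so the
    limit is one in the product topology, that is, pointwise.\<close>
  have "limitin (weak_star_topology smul) f 0 sequentially
      \<longleftrightarrow> (\<forall>V. open V \<longrightarrow> 0 \<in> blinfun_apply -` V \<inter> dual_space smul \<longrightarrow>
        (\<forall>\<^sub>F n in sequentially. f n \<in> blinfun_apply -` V \<inter> dual_space smul))"
    unfolding limitin_def weak_star_topology_def topspace_pullback_topology
      openin_pullback_topology topspace_euclidean open_openin[symmetric] using zero by blast
  also have "\<dots> \<longleftrightarrow> (\<lambda>n. blinfun_apply (f n)) \<longlonglongrightarrow> (\<lambda>x. 0)"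
    by (simp add: tendsto_def range_subsetD[OF True] zero zero_blinfun.rep_eq)
  also have "\<dots> \<longleftrightarrow> (\<forall>x. (\<lambda>n. blinfun_apply (f n) x) \<longlonglongrightarrow> 0)"
    using limitin_componentwise[of "\<lambda>_. euclidean" UNIV "\<lambda>n. blinfun_apply (f n)" "\<lambda>x. 0" sequentially]
    by (simp add: euclidean_product_topology)
  finally show ?thesis
    using True by (simp add: weak_star_null_def)
qed (simp add: weak_star_null_def)

lemma weak_topology_openin:
  "f \<in> dual_space smul \<Longrightarrow> open U \<Longrightarrow> openin (weak_topology smul) (blinfun_apply f -` U)"
  unfolding weak_topology_def by (intro topology_generated_by_Basis) blast

lemma topspace_weak_topology [simp]:
  fixes smul :: "'k::real_normed_field \<Rightarrow> 'a::banach \<Rightarrow> 'a"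
  shows "topspace (weak_topology smul) = UNIV"
proof -
  have "(0 :: 'a \<Rightarrow>\<^sub>L 'k) \<in> dual_space smul"
    by (simp add: dual_space_def)
  then have "openin (weak_topology smul) (blinfun_apply (0 :: 'a \<Rightarrow>\<^sub>L 'k) -` UNIV)"
    by (rule weak_topology_openin) simp
  then show ?thesis
    using openin_subset by fastforce
qed

lemma continuous_map_weak_dual:
  "f \<in> dual_space smul \<Longrightarrow> continuous_map (weak_topology smul) euclidean (blinfun_apply f)"
  by (auto simp: continuous_map_def vimage_def dest: weak_topology_openin)

lemma limitin_weak_topology_iff:
  "limitin (weak_topology smul) x l F \<longleftrightarrow>
    (\<forall>f\<in>dual_space smul. ((\<lambda>n. blinfun_apply f (x n)) \<longlongrightarrow> blinfun_apply f l) F)"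
proof
  assume lim: "limitin (weak_topology smul) x l F"
  show "\<forall>f\<in>dual_space smul. ((\<lambda>n. blinfun_apply f (x n)) \<longlongrightarrow> blinfun_apply f l) F"
    using continuous_map_limit[OF continuous_map_weak_dual lim] by (simp add: o_def)
next
  assume lim: "\<forall>f\<in>dual_space smul. ((\<lambda>n. blinfun_apply f (x n)) \<longlongrightarrow> blinfun_apply f l) F"
  have "\<forall>\<^sub>F n in F. x n \<in> U" if "openin (weak_topology smul) U" "l \<in> U" for U
  proof -
    \<comment> \<open>Convergence is known on the generating preimages; induction on how
      \<open>U\<close> is generated passes it through finite intersections and unions.\<close>
    have "generate_topology_on {blinfun_apply f -` U | f U. f \<in> dual_space smul \<and> open U} U"
      using that(1) unfolding weak_topology_def by (rule openin_topology_generated_by)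
    then show ?thesis
      using that(2)
    proof induction
      case (Int a b)
      then show ?case
        by (auto intro: eventually_conj)
    next
      case (UN K)
      then obtain k where k: "k \<in> K" "\<forall>\<^sub>F n in F. x n \<in> k"
        by blast
      from k(2) show ?case
        by eventually_elim (use k(1) in blast)
    next
      case (Basis s)
      then show ?case
        using lim by (auto dest!: topological_tendstoD)
    qed simp
  qed
  then show "limitin (weak_topology smul) x l F"
    by (simp add: limitin_def)
qed

text \<open>Preimages of balls under evaluation at \<open>x\<close> are convex. The hypothesis on
  \<open>range v\<close> also concerns the initial terms, on which the tail relation is
  silent.\<close>

lemma weak_star_null_tail_hulls:
  assumes "weak_star_null smul u" "eventually_in_tail_hulls v u" "range v \<subseteq> dual_space smul"
  shows "weak_star_null smul v"
  unfolding weak_star_null_iff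
proof (intro conjI allI)
  fix x
  show "(\<lambda>n. blinfun_apply (v n) x) \<longlonglongrightarrow> 0"
  proof (rule tendstoI)
    fix e :: real assume "0 < e"
    have "convex ((\<lambda>f. blinfun_apply f x) -` ball 0 e)"
      by (intro convex_linear_vimage convex_ball bounded_linear.linear blinfun.bounded_linear_left)
    moreover have "\<forall>\<^sub>F n in sequentially. u n \<in> (\<lambda>f. blinfun_apply f x) -` ball 0 e"
      using assms(1) \<open>0 < e\<close> by (auto simp: weak_star_null_iff tendsto_iff)
    ultimately have "\<forall>\<^sub>F n in sequentially. v n \<in> (\<lambda>f. blinfun_apply f x) -` ball 0 e"
      by (rule eventually_in_tail_hulls_convex[OF assms(2)])
    then show "\<forall>\<^sub>F n in sequentially. dist (blinfun_apply (v n) x) 0 < e"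
      by simp
  qed
qed (rule assms(3))

lemma convex_dual_space:
  fixes smul :: "'k::real_normed_field \<Rightarrow> 'a::banach \<Rightarrow> 'a"
  shows "convex (dual_space smul)"
proof (rule convexI)
  fix f g :: "'a \<Rightarrow>\<^sub>L 'k" and a b :: real
  assume "f \<in> dual_space smul" "g \<in> dual_space smul"
  then show "a *\<^sub>R f + b *\<^sub>R g \<in> dual_space smul"
    by (simp add: dual_space_def blinfun.add_left blinfun.scaleR_left algebra_simps)
qed

section \<open>Weak compactness and property (K)\<close>

text \<open>The hypothesis reduces linear functionals over the scalar field to real ones; over
  the complex numbers the witness is \<open>F x = u x - \<i> u (\<i> x)\<close>.\<close>
locale banach_over_real_dual = banach_over smul
  for smul :: "'k::{real_normed_field,second_countable_topology} \<Rightarrow> 'a::banach \<Rightarrow> 'a" +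
  assumes real_functional_dominated:
    "\<And>u :: 'a \<Rightarrow>\<^sub>L real. \<exists>F\<in>dual_space smul. norm F \<le> 2 * norm u \<and>
      (\<forall>x. norm (blinfun_apply u x) \<le> norm (blinfun_apply F x)) \<and>
      (\<forall>x. (\<forall>c. blinfun_apply u (smul c x) = 0) \<longrightarrow> blinfun_apply F x = 0)"
begin

section \<open>Separation, boundedness and separability over the scalar field\<close>

lemma bounded_linear_smul: "bounded_linear (\<lambda>c. smul c x)"
  by (rule bounded_linear_intro[where K = "norm x"])
    (simp_all add: scale_left_distrib norm_smul scaleR_conv_of_real
      flip: smul_of_real scale_scale)

text \<open>Real Hahn-Banach gives \<open>u\<close> vanishing on \<open>S\<close>; since
  \<open>S\<close> is closed under \<open>smul\<close>, \<open>u\<close> vanishes on all multiples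
  of each \<open>s\<close>, so the dominating \<open>F\<close> vanishes at \<open>s\<close>. The
  bound 2 comes from the domination hypothesis.\<close>

lemma dual_separates:
  assumes S: "subspace S"
  shows "\<exists>F\<in>dual_space smul. norm F \<le> 2 \<and> (\<forall>s\<in>S. blinfun_apply F s = 0) \<and>
    infdist x S \<le> norm (blinfun_apply F x)"
proof -
  have "real_vector.subspace S"
    using subspace_0[OF S] subspace_add[OF S] subspace_scale[OF S, of _ "of_real r" for r]
    by (intro real_vector.subspaceI) (auto simp: smul_of_real)
  then obtain u :: "'a \<Rightarrow>\<^sub>L real" where u: "norm u \<le> 1" "\<And>s. s \<in> S \<Longrightarrow> u s = 0" "infdist x S \<le> u x"
    using hahn_banach_subspace by blast
  obtain F where F: "F \<in> dual_space smul" "norm F \<le> 2 * norm u" "\<And>x. norm (u x) \<le> norm (blinfun_apply F x)"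
      "\<And>x. (\<And>c. u (smul c x) = 0) \<Longrightarrow> blinfun_apply F x = 0"
    using real_functional_dominated[of u] by blast
  have "F s = 0" if "s \<in> S" for s
    using u(2) subspace_scale[OF S that] by (intro F(4)) auto
  moreover have "infdist x S \<le> norm (F x)"
    using u(3) F(3)[of x] by simp
  ultimately show ?thesis
    using F(1,2) u(1) by (intro bexI[of _ F]) auto
qed

text \<open>Uniform boundedness is applied to the evaluations at \<open>x n\<close>, acting on the
  Banach space of real bounded functionals. Pointwise bounds come from a dominating \<open>F\<close>
  in the dual space.\<close>

lemma weakly_null_bounded:
  assumes "weakly_null smul x"
  shows "bounded (range x)"
proof -
  define E where "E n = Blinfun (\<lambda>u :: 'a \<Rightarrow>\<^sub>L real. u (x n))" for n
  have E: "E n u = u (x n)" for n u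
    unfolding E_def by (simp add: bounded_linear_Blinfun_apply blinfun.bounded_linear_left)
  have "bounded (range (\<lambda>n. E n u))" for u
  proof -
    obtain F where F: "F \<in> dual_space smul" "\<And>x. norm (u x) \<le> norm (blinfun_apply F x)"
      using real_functional_dominated[of u] by blast
    have "(\<lambda>n. F (x n)) \<longlonglongrightarrow> F 0"
      using assms F(1) by (auto simp: weakly_null_def limitin_weak_topology_iff)
    then have "bounded (range (\<lambda>n. F (x n)))"
      by (rule convergent_imp_bounded)
    then show ?thesis
      using F(2) by (auto simp: bounded_iff E intro: order_trans)
  qed
  then have "bounded (range E)"
    by (rule uniform_boundedness)
  then obtain b where b: "\<And>n. norm (E n) \<le> b"
    by (auto simp: bounded_iff)
  have "norm (x n) \<le> b" for n
  proof -
    \<comment> \<open>The distance to \<open>{0}\<close> is the norm, so this is a norming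
      functional; it recovers \<open>norm (x n)\<close> from \<open>norm (E n)\<close>.\<close>
    obtain u :: "'a \<Rightarrow>\<^sub>L real" where u: "norm u \<le> 1" "infdist (x n) {0} \<le> u (x n)"
      using hahn_banach_subspace[OF real_vector.subspace_single_0, of "x n"] by blast
    have "norm (x n) \<le> E n u"
      using u(2) by (simp add: E)
    also have "\<dots> \<le> norm (E n) * norm u"
      using norm_blinfun[of "E n" u] by simp
    also have "\<dots> \<le> b * 1"
      using u(1) b[of n] by (intro mult_mono) (auto intro: order_trans[OF norm_ge_zero])
    finally show ?thesis by simp
  qed
  then show ?thesis
    by (auto simp: bounded_iff)
qed

text \<open>The coefficients are taken from a countable dense subset of the product space of scalar
  sequences, available by second countability of the scalars. Each \<open>L n\<close> is continuous
  in the coefficients, so these combinations are dense in the span.\<close>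

lemma countable_dense_in_sequence_span:
  fixes x :: "nat \<Rightarrow> 'a"
  obtains S D where "subspace S" "range x \<subseteq> S" "countable D" "S \<subseteq> closure D"
proof -
  define L where "L n c = (\<Sum>i<n. smul (c i) (x i))" for n :: nat and c :: "nat \<Rightarrow> 'k"
  define S where "S = {L n c | n c. True}"
  obtain Q :: "(nat \<Rightarrow> 'k) set" where Q: "countable Q" "\<And>X. open X \<Longrightarrow> X \<noteq> {} \<Longrightarrow> \<exists>q\<in>Q. q \<in> X"
    using countable_dense_setE by blast
  define D where "D = (\<lambda>(n, q). L n q) ` (UNIV \<times> Q)"
  \<comment> \<open>Zero padding brings two combinations to a common length so that they can be
    added.\<close>
  have pad: "L n c = L m (\<lambda>i. if i < n then c i else 0)" if "n \<le> m" for n m c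
    unfolding L_def using that by (intro sum.mono_neutral_cong_left) auto
  have "subspace S"
  proof (rule subspaceI)
    show "0 \<in> S"
      unfolding S_def by (intro CollectI exI[of _ 0]) (simp add: L_def)
  next
    fix a b assume "a \<in> S" "b \<in> S"
    then obtain n c m d where "a = L n c" "b = L m d"
      by (auto simp: S_def)
    then obtain k c' d' where "a = L k c'" "b = L k d'"
      using pad[of n "max n m" c] pad[of m "max n m" d] by (metis max.cobounded1 max.cobounded2)
    then have "a + b = L k (\<lambda>i. c' i + d' i)"
      by (simp add: L_def scale_left_distrib sum.distrib)
    then show "a + b \<in> S"
      by (auto simp: S_def)
  next
    fix r a assume "a \<in> S"
    then obtain n c where "a = L n c"
      by (auto simp: S_def)
    then have "smul r a = L n (\<lambda>i. r * c i)"
      by (simp add: L_def scale_sum_right)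
    then show "smul r a \<in> S"
      by (auto simp: S_def)
  qed
  moreover have "x i \<in> S" for i
  proof -
    have "x i = L (Suc i) (\<lambda>j. if j = i then 1 else 0)"
      by (simp add: L_def)
    then show ?thesis
      by (auto simp: S_def)
  qed
  moreover have "countable D"
    using Q(1) by (auto simp: D_def)
  moreover have "L n c \<in> closure D" for n c
  proof -
    have cont: "continuous_on UNIV (L n)"
      unfolding L_def
      by (intro continuous_intros bounded_linear.continuous_on[OF bounded_linear_smul]
          continuous_on_product_coordinates)
    have "\<exists>d\<in>D. dist d (L n c) < e" if "0 < e" for e
    proof -
      have "open (L n -` ball (L n c) e)"
        using cont by (simp add: continuous_on_open_vimage)
      moreover have "c \<in> L n -` ball (L n c) e"
        using that by simp
      ultimately obtain q where "q \<in> Q" "q \<in> L n -` ball (L n c) e"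
        using Q(2) by blast
      then have "L n q \<in> D" "dist (L n q) (L n c) < e"
        by (auto simp: D_def dist_commute)
      then show ?thesis
        by blast
    qed
    then show ?thesis
      by (simp add: closure_approachable)
  qed
  ultimately show thesis
    by (intro that[of S D]) (auto simp: S_def)
qed

text \<open>The weak closure of the span of the sequence is separable, so countably many functionals
  separate its points. They embed the weakly compact set into the metrizable space of scalar
  sequences.\<close>
theorem weakly_compact_imp_sequentially_compact:
  fixes x :: "nat \<Rightarrow> 'a"
  assumes K: "compactin (weak_topology smul) K" and x: "range x \<subseteq> K"
  obtains r l where "strict_mono r" "limitin (weak_topology smul) (x \<circ> r) l sequentially"
proof -
  obtain S D where S: "subspace S" "range x \<subseteq> S" and D: "countable D" "S \<subseteq> closure D"
    by (rule countable_dense_in_sequence_span[of x])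
  have "D \<noteq> {}"
    using S D(2) by auto
  define d where "d = from_nat_into D"
  have d: "range d = D"
    using D(1) \<open>D \<noteq> {}\<close> by (simp add: d_def)
  have "\<exists>F\<in>dual_space smul. norm F \<le> 2 \<and> norm (d n) \<le> norm (blinfun_apply F (d n))" for n
    using dual_separates[OF subspace_single_0, of "d n"] by auto
  then obtain F where F: "\<And>n. F n \<in> dual_space smul" "\<And>n. norm (F n) \<le> 2"
      "\<And>n. norm (d n) \<le> norm (blinfun_apply (F n) (d n))"
    by metis
  \<comment> \<open>The common zero set of all functionals annihilating \<open>S\<close>. It is
    weakly closed by its form, and by \<open>dual_separates\<close> it lies in the norm closure of
    \<open>S\<close>.\<close>
  define Y where "Y = {y. \<forall>f\<in>dual_space smul. (\<forall>s\<in>S. blinfun_apply f s = 0) \<longrightarrow> blinfun_apply f y = 0}"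
  have Y_diff: "y - z \<in> Y" if "y \<in> Y" "z \<in> Y" for y z
    using that by (auto simp: Y_def blinfun.diff_right)
  have Y_closure: "y \<in> closure D" if "y \<in> Y" for y
  proof -
    obtain f where "f \<in> dual_space smul" "\<forall>s\<in>S. blinfun_apply f s = 0" "infdist y S \<le> norm (blinfun_apply f y)"
      using dual_separates[OF S(1)] by blast
    then have "infdist y S = 0"
      using that infdist_nonneg[of y S] by (auto simp: Y_def)
    then have "y \<in> closure S"
      using S by (subst in_closure_iff_infdist_zero) auto
    then show ?thesis
      using closure_minimal[OF D(2)] by auto
  qed
  \<comment> \<open>\<open>F n\<close> kills \<open>y\<close>, so \<open>norm (d n)\<close> is at
    most \<open>2 * norm (d n - y)\<close>; hence \<open>norm y\<close> is at most three times the
    distance from \<open>d n\<close>, which explains \<open>e / 3\<close>.\<close>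
  have separated: "y = 0" if y: "y \<in> Y" and zero: "\<And>n. F n y = 0" for y
  proof -
    have "norm y \<le> 0 + e" if "0 < e" for e
    proof -
      have "0 < e / 3"
        using that by simp
      then obtain z where "z \<in> D" "dist z y < e / 3"
        using Y_closure[OF y] unfolding closure_approachable by blast
      then obtain n where n: "norm (d n - y) < e / 3"
        using d by (auto simp: dist_norm)
      have "norm (d n) \<le> norm (F n (d n - y))"
        using F(3)[of n] zero by (simp add: blinfun.diff_right)
      also have "\<dots> \<le> norm (F n) * norm (d n - y)"
        by (rule norm_blinfun)
      also have "\<dots> \<le> 2 * norm (d n - y)"
        using F(2) by (intro mult_right_mono) auto
      finally show ?thesis
        using n norm_triangle_ineq4[of "d n" "d n - y"] by simp
    qed
    then show ?thesis
      using field_le_epsilon[of "norm y" 0] by simp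
  qed
  define \<Phi> where "\<Phi> y n = F n y" for y n
  have "continuous_map (weak_topology smul) (product_topology (\<lambda>_. euclidean) UNIV) \<Phi>"
    unfolding continuous_map_componentwise_UNIV \<Phi>_def
    using F(1) by (simp add: continuous_map_weak_dual)
  then have cont: "continuous_map (weak_topology smul) euclidean \<Phi>"
    by (simp add: euclidean_product_topology)
  have "closedin (weak_topology smul) (blinfun_apply f -` {0})" if "f \<in> dual_space smul" for f
    using closedin_continuous_map_preimage[OF continuous_map_weak_dual[OF that], of "{0}"]
    by (simp add: vimage_def)
  moreover have "Y = (\<Inter>f\<in>{f\<in>dual_space smul. \<forall>s\<in>S. blinfun_apply f s = 0}. blinfun_apply f -` {0})"
    by (auto simp: Y_def)
  moreover have "0 \<in> {f\<in>dual_space smul. \<forall>s\<in>S. blinfun_apply f s = 0}"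
    by (simp add: dual_space_def)
  ultimately have "closedin (weak_topology smul) Y"
    by (auto intro!: closedin_INT)
  then have KY: "compactin (weak_topology smul) (K \<inter> Y)"
    using K by (intro compact_Int_closedin)
  let ?W = "subtopology (weak_topology smul) (K \<inter> Y)"
  let ?P = "top_of_set (\<Phi> ` (K \<inter> Y))"
  \<comment> \<open>A continuous injection of a compact space into a Hausdorff space is a
    homeomorphism onto its image; the inverse carries convergent subsequences back to the weak
    topology.\<close>
  have "homeomorphic_map ?W ?P \<Phi>"
  proof (rule continuous_imp_homeomorphic_map)
    show "continuous_map ?W ?P \<Phi>"
      using cont by (auto simp: continuous_map_in_subtopology intro: continuous_map_from_subtopology)
    show "compact_space ?W"
      using KY by (simp add: compact_space_subtopology)
    show "inj_on \<Phi> (topspace ?W)"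
    proof (rule inj_onI)
      fix y z assume yz: "y \<in> topspace ?W" "z \<in> topspace ?W" "\<Phi> y = \<Phi> z"
      have "y - z = 0"
      proof (rule separated)
        show "F n (y - z) = 0" for n
          using fun_cong[OF yz(3), of n] by (simp add: \<Phi>_def blinfun.diff_right)
      qed (use yz Y_diff in auto)
      then show "y = z" by simp
    qed
  qed (auto simp: Hausdorff_space_subtopology)
  then obtain \<Psi> where \<Psi>: "homeomorphic_maps ?W ?P \<Phi> \<Psi>"
    by (auto simp: homeomorphic_map_maps)
  have xKY: "x n \<in> K \<inter> Y" for n
    using x S(2) by (auto simp: Y_def)
  have "compact (\<Phi> ` (K \<inter> Y))"
    using image_compactin[OF KY cont] by simp
  then have "seq_compact (\<Phi> ` (K \<inter> Y))"
    by (simp add: compact_eq_seq_compact_metric)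
  then obtain l r where l: "l \<in> \<Phi> ` (K \<inter> Y)" and r: "strict_mono r" "((\<lambda>n. \<Phi> (x n)) \<circ> r) \<longlonglongrightarrow> l"
    using xKY unfolding seq_compact_def by (metis imageI)
  have "limitin ?P ((\<lambda>n. \<Phi> (x n)) \<circ> r) l sequentially"
    unfolding limitin_subtopology using l r(2) xKY by simp
  then have "limitin ?W (\<Psi> \<circ> ((\<lambda>n. \<Phi> (x n)) \<circ> r)) (\<Psi> l) sequentially"
    using \<Psi> by (intro continuous_map_limit) (auto simp: homeomorphic_maps_def)
  moreover have "\<Psi> \<circ> ((\<lambda>n. \<Phi> (x n)) \<circ> r) = x \<circ> r"
    using \<Psi> xKY by (auto simp: homeomorphic_maps_def)
  ultimately show thesis
    using that r(1) by (auto simp: limitin_subtopology)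
qed

section \<open>From property (K) to vanishing \<alpha>\<close>

lemma property_K_imp_alpha_zero:
  fixes g :: "nat \<Rightarrow> 'a \<Rightarrow>\<^sub>L 'k"
  assumes g: "weak_star_null smul g"
    and null: "\<And>x. weakly_null smul x \<Longrightarrow> (\<lambda>n. g n (x n)) \<longlonglongrightarrow> 0"
  shows "alpha smul g = 0"
proof -
  have "limsup (\<lambda>n. SUP x\<in>K. ennreal (norm (g n x))) \<le> 0" if K: "K \<in> weakly_compact_in_ball smul" for K
  proof (rule Limsup_le_iff[THEN iffD2], intro allI impI)
    fix c :: ennreal assume "0 < c"
    \<comment> \<open>Passing through \<open>c'\<close> yields a positive real \<open>e\<close> even
      when \<open>c\<close> is infinite.\<close>
    then obtain c' where c': "0 < c'" "c' < c"
      using dense by blast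
    then obtain e where e: "0 < e" "ennreal e < c"
      by (cases c') (auto simp: ennreal_less_zero_iff)
    show "\<forall>\<^sub>F n in sequentially. (SUP x\<in>K. ennreal (norm (g n x))) < c"
    proof (rule ccontr)
      assume "\<not> ?thesis"
      then have "\<exists>\<^sub>F n in sequentially. c \<le> (SUP x\<in>K. ennreal (norm (g n x)))"
        by (simp add: not_eventually not_less)
      then have inf: "infinite {n. c \<le> (SUP x\<in>K. ennreal (norm (g n x)))}"
        by (simp add: frequently_cofinite flip: cofinite_eq_sequentially)
      define r where "r = enumerate {n. c \<le> (SUP x\<in>K. ennreal (norm (g n x)))}"
      have r: "strict_mono r"
        unfolding r_def using inf by (rule strict_mono_enumerate)
      have "\<exists>x\<in>K. e < norm (g (r k) x)" for k
      proof -
        have "ennreal e < (SUP x\<in>K. ennreal (norm (g (r k) x)))"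
          using e(2) enumerate_in_set[OF inf, of k] by (auto simp: r_def)
        then show ?thesis
          using e(1) by (auto simp: less_SUP_iff ennreal_less_iff)
      qed
      then obtain x where x: "\<And>k. x k \<in> K" "\<And>k. e < norm (g (r k) (x k))"
        by metis
      obtain s l where s: "strict_mono s" and
        l: "limitin (weak_topology smul) (x \<circ> s) l sequentially"
        using weakly_compact_imp_sequentially_compact[of K x] K x(1)
        by (auto simp: weakly_compact_in_ball_def)
      define t where "t = r \<circ> s"
      have t: "strict_mono t"
        unfolding t_def using r s by (rule strict_mono_o)
      \<comment> \<open>\<open>inv t\<close> recovers \<open>k\<close> from the index
        \<open>t k\<close>, so that \<open>g (t k)\<close> meets \<open>x (s k) - l\<close> at its
        own index.\<close>
      define y where "y n = (if n \<in> range t then x (s (inv t n)) - l else 0)" for n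
      have y: "y (t k) = x (s k) - l" for k
        using strict_mono_imp_inj_on[OF t] by (simp add: y_def)
      have "weakly_null smul y"
        unfolding weakly_null_def limitin_weak_topology_iff
      proof
        fix f :: "'a \<Rightarrow>\<^sub>L 'k" assume "f \<in> dual_space smul"
        then have "(\<lambda>k. f (x (s k))) \<longlonglongrightarrow> f l"
          using l by (auto simp: limitin_weak_topology_iff)
        then have "(\<lambda>k. f (y (t k))) \<longlonglongrightarrow> 0"
          using tendsto_diff[OF _ tendsto_const, of _ "f l" _ "f l"] by (simp add: y blinfun.diff_right)
        then have "(\<lambda>n. f (y n)) \<longlonglongrightarrow> 0"
          by (rule tendsto_zero_extend[OF t]) (simp add: y_def)
        then show "(\<lambda>n. f (y n)) \<longlonglongrightarrow> f 0"
          by simp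
      qed
      then have "(\<lambda>k. g (t k) (y (t k))) \<longlonglongrightarrow> 0"
        using LIMSEQ_subseq_LIMSEQ[OF null t] by (simp add: o_def)
      \<comment> \<open>The subtracted limit is harmless: \<open>l\<close> is a fixed vector and
        \<open>g\<close> is weak* null.\<close>
      moreover have "(\<lambda>k. g (t k) l) \<longlonglongrightarrow> 0"
        using LIMSEQ_subseq_LIMSEQ[OF _ t, of "\<lambda>n. g n l"] g by (simp add: o_def weak_star_null_iff)
      ultimately have "(\<lambda>k. g (t k) (y (t k)) + g (t k) l) \<longlonglongrightarrow> 0 + 0"
        by (rule tendsto_add)
      then have "(\<lambda>k. g (t k) (x (s k))) \<longlonglongrightarrow> 0"
        by (simp add: y blinfun.diff_right)
      then obtain k where "norm (g (t k) (x (s k))) < e"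
        using LIMSEQ_D[OF _ e(1)] by fastforce
      then show False
        using x(2)[of "s k"] by (simp add: t_def)
    qed
  qed
  then have "alpha smul g \<le> 0"
    unfolding alpha_def by (rule SUP_least)
  then show ?thesis
    by simp
qed

section \<open>From vanishing \<alpha> back to property (K)\<close>

lemma alpha_zero_imp_weakly_null_tendsto:
  fixes g :: "nat \<Rightarrow> 'a \<Rightarrow>\<^sub>L 'k"
  assumes alpha: "alpha smul g = 0" and x: "weakly_null smul x"
  shows "(\<lambda>n. g n (x n)) \<longlonglongrightarrow> 0"
proof -
  obtain M where M: "0 < M" "\<And>n. norm (x n) \<le> M"
    using weakly_null_bounded[OF x] by (auto simp: bounded_pos)
  define y where "y n = (1 / M) *\<^sub>R x n" for n
  \<comment> \<open>The whole sequence and its weak limit go into one set, so the supremum over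
    \<open>K\<close> dominates the diagonal term \<open>g n (y n)\<close>.\<close>
  define K where "K = insert 0 (range y)"
  have "limitin (weak_topology smul) y 0 sequentially"
    unfolding limitin_weak_topology_iff
  proof
    fix f :: "'a \<Rightarrow>\<^sub>L 'k" assume "f \<in> dual_space smul"
    then have "(\<lambda>n. f (x n)) \<longlonglongrightarrow> f 0"
      using x by (auto simp: weakly_null_def limitin_weak_topology_iff)
    from tendsto_scaleR[OF tendsto_const this, of "1 / M"]
    show "(\<lambda>n. f (y n)) \<longlonglongrightarrow> f 0"
      by (simp add: y_def blinfun.scaleR_right)
  qed
  then have "compactin (weak_topology smul) K"
    unfolding K_def by (rule compactin_sequence_with_limit) auto
  moreover have "K \<subseteq> cball 0 1"
    using M by (auto simp: K_def y_def)
  ultimately have "K \<in> weakly_compact_in_ball smul"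
    by (simp add: weakly_compact_in_ball_def)
  then have "limsup (\<lambda>n. SUP x\<in>K. ennreal (norm (g n x))) \<le> alpha smul g"
    unfolding alpha_def by (rule SUP_upper)
  then have limsup: "limsup (\<lambda>n. SUP x\<in>K. ennreal (norm (g n x))) \<le> 0"
    using alpha by simp
  have "(\<lambda>n. g n (y n)) \<longlonglongrightarrow> 0"
  proof (rule tendstoI)
    fix e :: real assume e: "0 < e"
    then have "\<forall>\<^sub>F n in sequentially. (SUP x\<in>K. ennreal (norm (g n x))) < ennreal e"
      using limsup by (intro Limsup_lessD) (simp add: order_le_less_trans[of _ 0])
    then show "\<forall>\<^sub>F n in sequentially. dist (g n (y n)) 0 < e"
    proof eventually_elim
      case (elim n)
      have "ennreal (norm (g n (y n))) \<le> (SUP x\<in>K. ennreal (norm (g n x)))"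
        by (rule SUP_upper) (simp add: K_def)
      then have "ennreal (norm (g n (y n))) < ennreal e"
        using elim by (rule order_le_less_trans)
      then show ?case
        by (simp add: ennreal_less_iff)
    qed
  qed
  from tendsto_scaleR[OF tendsto_const this, of M] show ?thesis
    using M(1) by (simp add: y_def blinfun.scaleR_right)
qed

lemma convex_block_subseqs_weak_star_null:
  assumes "weak_star_null smul f" "g \<in> convex_block_subseqs f"
  shows "weak_star_null smul g"
proof (rule weak_star_null_tail_hulls[OF assms(1)])
  show "eventually_in_tail_hulls g f"
    by (rule convex_block_subseqs_tail_hulls[OF assms(2)])
  show "range g \<subseteq> dual_space smul"
    using assms(1) convex_block_subseqs_subset[OF assms(2) convex_dual_space]
    by (simp add: weak_star_null_iff)
qed

text \<open>An infimum equal to 0 only provides blocks with arbitrarily small \<open>alpha\<close>.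
  By \<open>alpha_tail_hulls\<close> the diagonal sequence inherits the bounds of all stages
  simultaneously.\<close>

lemma K1_zero_imp_alpha_zero:
  fixes f :: "nat \<Rightarrow> 'a \<Rightarrow>\<^sub>L 'k"
  assumes K1: "K1 smul = 0" and f: "weak_star_null smul f" "\<And>n. norm (f n) \<le> 1"
  shows "\<exists>g\<in>convex_block_subseqs f. alpha smul g = 0"
proof -
  \<comment> \<open>The invariant keeps each stage admissible in the supremum defining
    \<open>K1\<close>; its last clause pins the start of the dependent choice to
    \<open>f\<close>.\<close>
  define P where "P n g \<longleftrightarrow> weak_star_null smul g \<and> (\<forall>i. norm (g i) \<le> 1) \<and> (n = 0 \<longrightarrow> g = f)"
    for n :: nat and g
  have "\<exists>g. \<forall>n. P n (g n) \<and> g (Suc n) \<in> convex_block_subseqs (g n) \<and>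
      alpha smul (g (Suc n)) < ennreal (1 / Suc n)"
  proof (rule dependent_nat_choice)
    show "\<exists>g. P 0 g"
      using f by (auto simp: P_def)
  next
    fix g n assume P: "P n g"
    then have "(INF h\<in>convex_block_subseqs g. alpha smul h) \<le> K1 smul"
      unfolding K1_def by (intro SUP_upper) (auto simp: P_def)
    then have "(INF h\<in>convex_block_subseqs g. alpha smul h) < ennreal (1 / Suc n)"
      using K1 by simp
    then obtain h where h: "h \<in> convex_block_subseqs g" "alpha smul h < ennreal (1 / Suc n)"
      by (auto simp: INF_less_iff)
    have "range h \<subseteq> cball 0 1"
      using P by (intro convex_block_subseqs_subset[OF h(1)]) (auto simp: P_def)
    then have "norm (h i) \<le> 1" for i
      by (simp add: image_subset_iff)
    then have "P (Suc n) h"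
      using P convex_block_subseqs_weak_star_null[OF _ h(1)] by (auto simp: P_def)
    then show "\<exists>h. P (Suc n) h \<and> h \<in> convex_block_subseqs g \<and> alpha smul h < ennreal (1 / Suc n)"
      using h by blast
  qed
  then obtain g where g: "g 0 = f" "\<And>n. g (Suc n) \<in> convex_block_subseqs (g n)"
      "\<And>n. alpha smul (g (Suc n)) < ennreal (1 / Suc n)"
    unfolding P_def by blast
  obtain h where h: "h \<in> convex_block_subseqs f" "\<And>m. eventually_in_tail_hulls h (g m)"
    using convex_block_diagonal[of g, OF g(2)] g(1) by blast
  have eps: "alpha smul h \<le> 0 + ennreal e" if "0 < e" for e
  proof -
    from \<open>0 < e\<close> obtain n where n: "1 / Suc n < e"
      by (rule nat_approx_posE)
    have "alpha smul h \<le> alpha smul (g (Suc n))"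
      by (rule alpha_tail_hulls[OF h(2)])
    also have "\<dots> \<le> ennreal (1 / Suc n)"
      using g(3) by (rule less_imp_le)
    also have "\<dots> \<le> ennreal e"
      using n by (intro ennreal_leI) simp
    finally show ?thesis by simp
  qed
  have "alpha smul h \<le> 0"
    by (rule ennreal_le_epsilon) (rule eps)
  then show ?thesis
    using h(1) by auto
qed

theorem property_K_iff_K1_zero: "property_K smul \<longleftrightarrow> K1 smul = 0"
proof
  assume K: "property_K smul"
  have "(INF g\<in>convex_block_subseqs f. alpha smul g) \<le> 0" if f: "weak_star_null smul f"
    for f :: "nat \<Rightarrow> 'a \<Rightarrow>\<^sub>L 'k"
  proof -
    obtain g where g: "g \<in> convex_block_subseqs f"
        "\<And>x. weakly_null smul x \<Longrightarrow> (\<lambda>n. blinfun_apply (g n) (x n)) \<longlonglongrightarrow> 0"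
      using K f unfolding property_K_def by blast
    have "alpha smul g = 0"
      using convex_block_subseqs_weak_star_null[OF f g(1)] g(2) by (rule property_K_imp_alpha_zero)
    then show ?thesis
      using INF_lower[OF g(1), of "alpha smul"] by simp
  qed
  then have "K1 smul \<le> 0"
    unfolding K1_def by (intro SUP_least) auto
  then show "K1 smul = 0"
    by simp
next
  assume K1: "K1 smul = 0"
  show "property_K smul"
    unfolding property_K_def
  proof (intro allI impI)
    fix f :: "nat \<Rightarrow> 'a \<Rightarrow>\<^sub>L 'k" assume f: "weak_star_null smul f"
    have "bounded (range (\<lambda>n. f n x))" for x
      using f by (intro convergent_imp_bounded) (auto simp: weak_star_null_iff)
    then have "bounded (range f)"
      by (rule uniform_boundedness)
    then obtain M where M: "0 < M" "\<And>n. norm (f n) \<le> M"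
      by (auto simp: bounded_pos)
    define f' where "f' n = (1 / M) *\<^sub>R f n" for n
    have "range f' \<subseteq> dual_space smul"
      using f by (auto simp: f'_def weak_star_null_iff dual_space_def blinfun.scaleR_left)
    moreover have "(\<lambda>n. f' n x) \<longlonglongrightarrow> 0" for x
      using tendsto_scaleR[OF tendsto_const, of "\<lambda>n. f n x" 0 sequentially "1 / M"] f
      by (simp add: f'_def weak_star_null_iff blinfun.scaleR_left)
    ultimately have "weak_star_null smul f'"
      by (simp add: weak_star_null_iff)
    moreover have "norm (f' n) \<le> 1" for n
      using M by (simp add: f'_def)
    ultimately obtain g where g: "g \<in> convex_block_subseqs f'" "alpha smul g = 0"
      using K1_zero_imp_alpha_zero[OF K1] by blast
    have "(\<lambda>n. M *\<^sub>R f' n) = f"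
      using M by (simp add: f'_def)
    then have "(\<lambda>n. M *\<^sub>R g n) \<in> convex_block_subseqs f"
      using convex_block_subseqs_scaleR[OF g(1), of M] by simp
    moreover have "(\<lambda>n. (M *\<^sub>R g n) (x n)) \<longlonglongrightarrow> 0" if "weakly_null smul x" for x
      using tendsto_scaleR[OF tendsto_const alpha_zero_imp_weakly_null_tendsto[OF g(2) that], of M]
      by (simp add: blinfun.scaleR_left)
    ultimately show "\<exists>g\<in>convex_block_subseqs f. \<forall>x. weakly_null smul x \<longrightarrow> (\<lambda>n. blinfun_apply (g n) (x n)) \<longlonglongrightarrow> 0"
      by (intro bexI[of _ "\<lambda>n. M *\<^sub>R g n"]) simp_all
  qed
qed

end

section \<open>Real and complex scalars\<close>

lemma banach_over_real_dual_scaleR: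
  "banach_over_real_dual (scaleR :: real \<Rightarrow> 'a::banach \<Rightarrow> 'a)"
proof
  fix u :: "'a \<Rightarrow>\<^sub>L real"
  have "u \<in> dual_space scaleR"
    by (simp add: dual_space_def blinfun.scaleR_right)
  moreover have "u x = 0" if "\<forall>c. u (c *\<^sub>R x) = 0" for x
    using spec[OF that, of 1] by simp
  ultimately show "\<exists>F\<in>dual_space scaleR. norm F \<le> 2 * norm u \<and>
      (\<forall>x. norm (u x) \<le> norm (blinfun_apply F x)) \<and>
      (\<forall>x. (\<forall>c. u (c *\<^sub>R x) = 0) \<longrightarrow> blinfun_apply F x = 0)"
    by (intro bexI[of _ u]) simp_all
qed (auto simp: algebra_simps)

lemma banach_over_real_dual_complex:
  fixes smul :: "complex \<Rightarrow> 'a::banach \<Rightarrow> 'a"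
  assumes "banach_over smul"
  shows "banach_over_real_dual smul"
proof -
  interpret banach_over smul
    by (rule assms)
  show ?thesis
  proof
    fix u :: "'a \<Rightarrow>\<^sub>L real"
    define F where "F x = Complex (u x) (- u (smul \<i> x))" for x
    \<comment> \<open>Every complex multiple of \<open>x\<close> is a real combination of
      \<open>x\<close> and \<open>smul \<i> x\<close>, so complex homogeneity of \<open>F\<close>
      reduces to real linearity of \<open>u\<close>.\<close>
    have smul_eq: "smul c x = Re c *\<^sub>R x + Im c *\<^sub>R smul \<i> x" for c x
    proof -
      have "smul c x = smul (of_real (Re c) + of_real (Im c) * \<i>) x"
        by (simp add: complex_eq mult.commute)
      then show ?thesis
        by (simp add: scale_left_distrib smul_of_real flip: scale_scale)
    qed
    have F_smul: "F (smul c x) = c * F x" for c x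
    proof -
      have "smul \<i> (smul c x) = smul (\<i> * c) x"
        by simp
      then show ?thesis
        using smul_eq[of c x] smul_eq[of "\<i> * c" x]
        by (simp add: F_def complex_eq_iff blinfun.add_right blinfun.scaleR_right blinfun.diff_right)
    qed
    \<comment> \<open>The factor 2 arises from bounding real and imaginary parts separately;
      multiplication by \<i> preserves the norm.\<close>
    have norm_F: "norm (F x) \<le> norm x * (2 * norm u)" for x
    proof -
      have "norm (F x) \<le> \<bar>u x\<bar> + \<bar>u (smul \<i> x)\<bar>"
        using cmod_le[of "F x"] by (simp add: F_def)
      also have "\<dots> \<le> norm u * norm x + norm u * norm (smul \<i> x)"
        using norm_blinfun[of u x] norm_blinfun[of u "smul \<i> x"] by simp
      finally show ?thesis
        by (simp add: norm_smul algebra_simps)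
    qed
    have "bounded_linear F"
    proof (rule bounded_linear_intro[OF _ _ norm_F])
      show "F (x + y) = F x + F y" for x y
        by (simp add: F_def complex_eq_iff scale_right_distrib blinfun.add_right)
      show "F (r *\<^sub>R x) = r *\<^sub>R F x" for r x
        using F_smul[of "of_real r" x] by (simp add: smul_of_real scaleR_conv_of_real)
    qed
    then have apply_F: "blinfun_apply (Blinfun F) = F"
      by (rule bounded_linear_Blinfun_apply)
    have "Blinfun F \<in> dual_space smul"
      by (simp add: dual_space_def apply_F F_smul)
    moreover have "norm (Blinfun F) \<le> 2 * norm u"
      using norm_F by (intro norm_blinfun_bound) (auto simp: apply_F mult.commute)
    moreover have "norm (u x) \<le> norm (F x)" for x
      using abs_Re_le_cmod[of "F x"] by (simp add: F_def)
    moreover have "F x = 0" if "\<forall>c. u (smul c x) = 0" for x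
      using spec[OF that, of 1] spec[OF that, of \<i>] by (simp add: F_def complex_eq_iff)
    ultimately show "\<exists>F\<in>dual_space smul. norm F \<le> 2 * norm u \<and>
        (\<forall>x. norm (u x) \<le> norm (blinfun_apply F x)) \<and>
        (\<forall>x. (\<forall>c. u (smul c x) = 0) \<longrightarrow> blinfun_apply F x = 0)"
      by (intro bexI[of _ "Blinfun F"]) (auto simp: apply_F)
  qed
qed

theorem theorem3p6:
  fixes scaleC :: "complex \<Rightarrow> 'b::banach \<Rightarrow> 'b"
  shows "(infinite_dimensional (scaleR :: real \<Rightarrow> 'a::banach \<Rightarrow> 'a) \<longrightarrow>
            (property_K (scaleR :: real \<Rightarrow> 'a \<Rightarrow> 'a) \<longleftrightarrow> K1 (scaleR :: real \<Rightarrow> 'a \<Rightarrow> 'a) = 0)) \<and>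
         (banach_over scaleC \<and> infinite_dimensional scaleC \<longrightarrow>
            (property_K scaleC \<longleftrightarrow> K1 scaleC = 0))"
  using banach_over_real_dual.property_K_iff_K1_zero[OF banach_over_real_dual_scaleR]
    banach_over_real_dual.property_K_iff_K1_zero[OF banach_over_real_dual_complex]
  by blast

end
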